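(* Let $\mathcal{F}=\{K_1,\dots,K_d\}$ be a well separated family of convex bodies in $\mathbb{R}^d$, and let $\alpha=(\alpha_1,\dots,\alpha_d)\in[0,1]^d$. Then there is a unique positive transversal halfspace $H$ to $\mathcal{F}$ such that $\mathrm{Vol}(K_i\cap H)=\alpha_i\cdot\mathrm{Vol}(K_i)$ for every $i\in\{1,\dots,d\}$.
   Context: A convex body in $\mathbb{R}^d$ is a compact convex set with nonempty interior. A family $\mathcal{F}$ of connected sets in $\mathbb{R}^d$ is well separated if for any $k\le d+1$ distinct members $K_1,\dots,K_k$ of $\mathcal{F}$ and any points $x_i\in\mathrm{conv}\,K_i$, the affine hull $\mathrm{aff}\{x_1,\dots,x_k\}$ is a $(k-1)$-dimensional flat. For a unit vector $v\in S^{d-1}$ and $t\in\mathbb{R}$ write $H(v\le t)=\{x\in\mathbb{R}^d:\langle x,v\rangle\le t\}$ and $H(v=t)=\{x:\langle x,v\rangle=t\}$. A hyperplane is transversal to $\mathcal{F}$ if it meets every member of $\mathcal{F}$. For points $a_1,\dots,a_d$ with $a_i\in K_i$ (so $\mathrm{aff}\{a_1,\dots,a_d\}$ is a hyperplane), let $v(a_1,\dots,a_d)$ be the unique unit normal vector $v$ to $\mathrm{aff}\{a_1,\dots,a_d\}$ for which the $(d+1)\times(d+1)$ determinant with first row $(v,a_1,\dots,a_d)$ (vectors written as columns) and last row $(0,1,\dots,1)$ is positive. For a hyperplane $L$ transversal to $\mathcal{F}$, choose $a_i\in K_i\cap L$; then $L=\mathrm{aff}\{a_1,\dots,a_d\}$,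 the vector $v=v(a_1,\dots,a_d)$ does not depend on the choice of the $a_i$, and writing $L=H(v=t)$, the halfspace $H(v\le t)$ is called the positive transversal halfspace to $\mathcal{F}$ (with bounding hyperplane $L$). $\mathrm{Vol}$ denotes $d$-dimensional Lebesgue measure. *)

theory Defs
  imports "HOL-Analysis.Analysis"
begin

definition convex_body :: "'a::euclidean_space set \<Rightarrow> bool" where
  "convex_body K \<longleftrightarrow> compact K \<and> convex K \<and> interior K \<noteq> {}"

text \<open>A choice of points \<open>x\<^sub>i\<close> in the convex hulls of the members of a subfamily \<open>S\<close> is
  encoded as a function on the members themselves; \<open>card S\<close> counts distinct members.\<close>

definition well_separated :: "'a::euclidean_space set set \<Rightarrow> bool" where
  "well_separated F \<longleftrightarrow>
     (\<forall>A\<in>F. connected A) \<and>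
     (\<forall>S x. S \<subseteq> F \<and> finite S \<and> 1 \<le> card S \<and> card S \<le> DIM('a) + 1 \<and>
            (\<forall>A\<in>S. x A \<in> convex hull A) \<longrightarrow>
            aff_dim (affine hull (x ` S)) = int (card S) - 1)"

definition halfspace_le :: "'a::euclidean_space \<Rightarrow> real \<Rightarrow> 'a set" where
  "halfspace_le v t = {x. x \<bullet> v \<le> t}"

definition level_hyperplane :: "'a::euclidean_space \<Rightarrow> real \<Rightarrow> 'a set" where
  "level_hyperplane v t = {x. x \<bullet> v = t}"

definition transversal_hyperplane :: "'a::euclidean_space set set \<Rightarrow> 'a set \<Rightarrow> bool" where
  "transversal_hyperplane F L \<longleftrightarrow>
     affine L \<and> aff_dim L = int DIM('a) - 1 \<and> (\<forall>A\<in>F. L \<inter> A \<noteq> {})"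

text \<open>The determinant of the square matrix of size \<open>d + 1\<close> with columns, from left to right,
  \<open>(v, 0), (a\<^sub>1, 1), \<dots>, (a\<^sub>d, 1)\<close>, where \<open>d = CARD('n)\<close>.  The type \<open>'n\<close> indexes both the
  coordinates and the points \<open>a\<^sub>i\<close>.  In the matrix below, row \<open>None\<close> is the bottom row
  \<open>(0, 1, \<dots>, 1)\<close> and column \<open>None\<close> is \<open>(v, 0)\<close>.  Rows and columns of a HOL matrix share one
  index type, so with \<open>None\<close> last this is the matrix with columns
  \<open>(a\<^sub>1, 1), \<dots>, (a\<^sub>d, 1), (v, 0)\<close>; moving the last column to the first place contributes the
  sign \<open>(-1)\<^sup>d\<close>.  The value is the same for every enumeration of \<open>'n\<close>, as an enumeration
  permutes the coordinates and the points simultaneously.\<close>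

definition orientation_det :: "real^'n \<Rightarrow> ('n \<Rightarrow> real^'n) \<Rightarrow> real" where
  "orientation_det v a =
     (-1) ^ CARD('n) *
     det ((\<chi> r c. case r of
             Some j \<Rightarrow> (case c of None \<Rightarrow> v $ j | Some i \<Rightarrow> a i $ j)
           | None \<Rightarrow> (case c of None \<Rightarrow> 0 | Some i \<Rightarrow> 1)) :: real^('n option)^('n option))"

text \<open>Well defined when the points \<open>a i\<close> are affinely independent, i.e. span a hyperplane.\<close>

definition positive_normal :: "('n \<Rightarrow> real^'n) \<Rightarrow> real^'n" where
  "positive_normal a =
     (THE v. norm v = 1 \<and>
             (\<forall>x\<in>affine hull (range a). \<forall>y\<in>affine hull (range a). v \<bullet> (x - y) = 0) \<and>
             orientation_det v a > 0)"

text \<open>For a well separated family the normal does not depend on the choice of the points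
  \<open>a i\<close> in \<open>K i \<inter> L\<close>.\<close>

definition positive_transversal_halfspace ::
    "('n \<Rightarrow> (real^'n) set) \<Rightarrow> (real^'n) set \<Rightarrow> bool" where
  "positive_transversal_halfspace K H \<longleftrightarrow>
     (\<exists>L a t. transversal_hyperplane (range K) L \<and> (\<forall>i. a i \<in> K i \<inter> L) \<and>
              L = level_hyperplane (positive_normal a) t \<and>
              H = halfspace_le (positive_normal a) t)"

end

(* The determinant orientation_det v a is linear in v, so it equals the inner product of v with a
   vector N(a), the generalised cross product of the points a i.  When the points span a
   hyperplane, N(a) is a nonzero normal vector of it, pointing in the direction of
   positive_normal a, and orientation_det v a is nonzero for every normal v of the hyperplane.

   Existence: on the product of the K i, send y to the point whose i-th component is the projection
   to K i of y i - c i N(y), where c i is the volume of the part of K i below the hyperplane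
   through y, minus alpha i Vol(K i).  By Brouwer this map has a fixed point, and there every c i
   vanishes.

   Uniqueness: let f = <., v> - t and g = <., w> - u define two solutions.  Comparing volumes gives
   a i in K i with f (a i) = 0 and b i in K i with g (b i) = 0 such that a i = b i or g (a i) and
   f (b i) have the same sign.  Then (1 - s) f - s g vanishes at a point c s i of the segment from
   a i to b i depending continuously on s, with c 0 = a and c 1 = b.  The determinant of
   (1 - s) v - s w and c s is positive at s = 0 and negative at s = 1, and can vanish only where
   (1 - s) v = s w; as v and w are unit vectors, s = 1/2 and v = w. *)

theory Submission
  imports Defs
begin

section \<open>Kernel, linearity and continuity of the orientation determinant\<close>

lemma sum_UNIV_option:
  fixes f :: "'n::finite option \<Rightarrow> 'b::comm_monoid_add"
  shows "sum f UNIV = f None + (\<Sum>i\<in>UNIV. f (Some i))"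
  by (simp add: UNIV_option_conv sum.reindex)

text \<open>A vanishing determinant means a nonzero kernel vector: \<open>s\<close> is its entry at
  \<open>None\<close>, the \<open>c i\<close> are its entries at \<open>Some i\<close>, and the
  bottom row of the matrix contributes the condition on \<open>sum c UNIV\<close>.\<close>

lemma orientation_det_eq_0_iff:
  fixes v :: "real^'n"
  shows "orientation_det v a = 0 \<longleftrightarrow>
    (\<exists>s c. (s \<noteq> 0 \<or> (\<exists>i. c i \<noteq> 0)) \<and> s *\<^sub>R v + (\<Sum>i\<in>UNIV. c i *\<^sub>R a i) = 0 \<and> sum c UNIV = 0)"
    (is "_ \<longleftrightarrow> ?R")
proof -
  define A :: "real^('n option)^('n option)" where
    "A = (\<chi> r c. case r of
             Some j \<Rightarrow> (case c of None \<Rightarrow> v $ j | Some i \<Rightarrow> a i $ j)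
           | None \<Rightarrow> (case c of None \<Rightarrow> 0 | Some i \<Rightarrow> 1))"
  have ker: "A *v x = 0 \<longleftrightarrow> x $ None *\<^sub>R v + (\<Sum>i\<in>UNIV. x $ Some i *\<^sub>R a i) = 0 \<and>
      (\<Sum>i\<in>UNIV. x $ Some i) = 0" for x
    by (simp add: vec_eq_iff A_def matrix_vector_mult_def split_option_all sum_UNIV_option
        mult.commute conj_commute)
  have nz: "x \<noteq> 0 \<longleftrightarrow> x $ None \<noteq> 0 \<or> (\<exists>i. x $ Some i \<noteq> 0)" for x :: "real^('n option)"
    by (simp add: vec_eq_iff split_option_all)
  have "orientation_det v a = 0 \<longleftrightarrow> det A = 0"
    by (simp add: orientation_det_def A_def)
  also have "\<dots> \<longleftrightarrow> (\<exists>x. x \<noteq> 0 \<and> A *v x = 0)"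
    by (metis invertible_det_nz invertible_left_inverse matrix_left_invertible_ker)
  also have "\<dots> \<longleftrightarrow> ?R"
  proof
    assume "\<exists>x. x \<noteq> 0 \<and> A *v x = 0"
    then obtain x where "x \<noteq> 0" "A *v x = 0" by blast
    then show ?R
      unfolding ker nz by (intro exI[of _ "x $ None"] exI[of _ "\<lambda>i. x $ Some i"]) simp
  next
    assume ?R
    then obtain s c where sc: "s \<noteq> 0 \<or> (\<exists>i. c i \<noteq> 0)"
      "s *\<^sub>R v + (\<Sum>i\<in>UNIV. c i *\<^sub>R a i) = 0" "sum c UNIV = 0" by (elim exE conjE)
    define x :: "real^('n option)" where "x = (\<chi> k. case k of None \<Rightarrow> s | Some i \<Rightarrow> c i)"
    show "\<exists>x. x \<noteq> 0 \<and> A *v x = 0"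
      using sc by (intro exI[of _ x]) (unfold ker nz, simp add: x_def)
  qed
  finally show ?thesis .
qed

lemma orientation_det_diff_eq_0:
  fixes a :: "'n::finite \<Rightarrow> real^'n"
  shows "orientation_det (a i - a j) a = 0"
proof -
  \<comment> \<open>With \<open>s = 1\<close> the relation is nontrivial even for
    \<open>i = j\<close>, where \<open>c\<close> vanishes identically.\<close>
  define c :: "'n \<Rightarrow> real" where "c k = (if k = j then 1 else 0) - (if k = i then 1 else 0)" for k
  have "c k *\<^sub>R a k = (if k = j then a k else 0) - (if k = i then a k else 0)" for k
    by (auto simp: c_def)
  then have "(\<Sum>k\<in>UNIV. c k *\<^sub>R a k) = a j - a i"
    by (simp add: sum_subtractf)
  moreover have "sum c UNIV = 0"
    by (simp add: c_def sum_subtractf)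
  ultimately show ?thesis
    unfolding orientation_det_eq_0_iff
    by (intro exI[of _ 1] exI[of _ c]) simp
qed

text \<open>A determinant is additive and homogeneous in each row; transposing turns the column that
  contains \<open>v\<close> into the row \<open>None\<close>.\<close>

lemma linear_orientation_det:
  fixes a :: "'n::finite \<Rightarrow> real^'n"
  shows "linear (\<lambda>v. orientation_det v a)"
proof -
  define R :: "real^'n \<Rightarrow> real^('n option)" where
    "R v = (\<chi> c. case c of None \<Rightarrow> 0 | Some j \<Rightarrow> v $ j)" for v
  \<comment> \<open>At \<open>None\<close> this mentions the unspecified value
    \<open>the None\<close>, but that row is always replaced by \<open>R v\<close>.\<close>
  define Q :: "'n option \<Rightarrow> real^('n option)" where
    "Q r = (\<chi> c. case c of None \<Rightarrow> 1 | Some j \<Rightarrow> a (the r) $ j)" for r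
  have eq: "orientation_det v a = (-1) ^ CARD('n) * det (\<chi> r. if r = None then R v else Q r)" for v
  proof -
    have "(\<chi> r. if r = None then R v else Q r) = transpose (\<chi> r c. case r of
             Some j \<Rightarrow> (case c of None \<Rightarrow> v $ j | Some i \<Rightarrow> a i $ j)
           | None \<Rightarrow> (case c of None \<Rightarrow> 0 | Some i \<Rightarrow> 1))"
      by (simp add: vec_eq_iff transpose_def R_def Q_def split_option_all)
    then show ?thesis
      by (simp add: orientation_det_def det_transpose)
  qed
  have add: "R (x + y) = R x + R y" and mul: "R (s *\<^sub>R x) = s *s R x" for x y s
    by (simp_all add: R_def vec_eq_iff split_option_all)
  show ?thesis
  proof (rule linearI)
    show "orientation_det (x + y) a = orientation_det x a + orientation_det y a" for x y
      unfolding eq add using det_row_add[of None "\<lambda>_. R x" "\<lambda>_. R y" Q] by (simp add: distrib_left)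
    show "orientation_det (s *\<^sub>R x) a = s *\<^sub>R orientation_det x a" for s x
      unfolding eq mul using det_row_mul[of None s "\<lambda>_. R x" Q] by simp
  qed
qed

lemma continuous_on_orientation_det [continuous_intros]:
  fixes f :: "'a::topological_space \<Rightarrow> real^'n::finite"
  assumes "continuous_on S f" "\<And>i. continuous_on S (\<lambda>x. g x i)"
  shows "continuous_on S (\<lambda>x. orientation_det (f x) (g x))"
proof -
  define M :: "'a \<Rightarrow> real^('n option)^('n option)" where
    "M x = (\<chi> r c. case r of
             Some j \<Rightarrow> (case c of None \<Rightarrow> f x $ j | Some i \<Rightarrow> g x i $ j)
           | None \<Rightarrow> (case c of None \<Rightarrow> 0 | Some i \<Rightarrow> 1))" for x
  have "continuous_on S (\<lambda>x. M x $ r $ c)" for r c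
    using assms by (cases r; cases c) (simp_all add: M_def continuous_on_component)
  then have "continuous_on S (\<lambda>x. (-1) ^ CARD('n) * det (M x))"
    unfolding det_def
    by (intro continuous_on_mult continuous_on_const continuous_on_sum continuous_on_prod)
  then show ?thesis
    by (simp add: orientation_det_def M_def)
qed

text \<open>Pair a relation between the columns with \<open>v\<close>. All
  \<open>v \<bullet> a i\<close> are equal and the coefficients \<open>c\<close> sum to zero, so
  only \<open>s * (v \<bullet> v)\<close> survives and \<open>s = 0\<close>. What remains is an
  affine dependence of the points, which the dimension excludes.\<close>

lemma orientation_det_nonzero:
  fixes a :: "'n::finite \<Rightarrow> real^'n"
  assumes dim: "aff_dim (range a) = int CARD('n) - 1"
    and "v \<noteq> 0" and perp: "\<And>i j. v \<bullet> (a i - a j) = 0"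
  shows "orientation_det v a \<noteq> 0"
proof
  assume "orientation_det v a = 0"
  then obtain s c where sc: "s \<noteq> 0 \<or> (\<exists>i. c i \<noteq> 0)"
      "s *\<^sub>R v + (\<Sum>i\<in>UNIV. c i *\<^sub>R a i) = 0" "sum c UNIV = 0"
    unfolding orientation_det_eq_0_iff by blast
  \<comment> \<open>A flat of dimension \<open>CARD('n) - 1\<close> cannot be spanned by fewer than
    \<open>CARD('n)\<close> points, so the \<open>a i\<close> are distinct and affinely
    independent.\<close>
  have "card (range a) \<ge> CARD('n)"
    using aff_dim_le_card[of "range a"] dim by simp
  then have card: "card (range a) = CARD('n)"
    using card_image_le[of UNIV a] by simp
  then have inj: "inj a"
    by (simp add: eq_card_imp_inj_on)
  have indep: "\<not> affine_dependent (range a)"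
    using dim card by (simp add: affine_independent_iff_card)
  obtain k :: 'n where True by simp
  have "v \<bullet> (\<Sum>i\<in>UNIV. c i *\<^sub>R a i) = (\<Sum>i\<in>UNIV. c i * (v \<bullet> a k))"
    using perp[of _ k] by (auto simp: inner_sum_right inner_diff_right intro!: sum.cong)
  also have "\<dots> = 0"
    using sc(3) by (simp flip: sum_distrib_right)
  finally have "s * (v \<bullet> v) = 0"
    using arg_cong[OF sc(2), of "\<lambda>x. v \<bullet> x"] by (simp add: inner_add_right)
  then have "s = 0"
    using \<open>v \<noteq> 0\<close> by simp
  then obtain i where i: "c i \<noteq> 0" and comb: "(\<Sum>i\<in>UNIV. c i *\<^sub>R a i) = 0"
    using sc by auto
  have "affine_dependent (range a)"
    using i comb sc(3) inj
    by (simp add: affine_dependent_explicit_finite, intro exI[of _ "\<lambda>x. c (inv a x)"])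
      (auto simp: sum.reindex)
  with indep show False by blast
qed

section \<open>The generalised cross product and the positive normal\<close>

text \<open>This vector represents the linear functional \<open>orientation_det _ a\<close>. Unlike
  the normalised \<open>positive_normal\<close>, it is given by an explicit formula continuous in
  all choices of points.\<close>

definition hyperplane_normal :: "('n::finite \<Rightarrow> real^'n) \<Rightarrow> real^'n" where
  "hyperplane_normal a = (\<Sum>b\<in>Basis. orientation_det b a *\<^sub>R b)"

lemma inner_hyperplane_normal:
  "v \<bullet> hyperplane_normal a = orientation_det v a"
proof -
  interpret linear "\<lambda>v. orientation_det v a" by (rule linear_orientation_det)
  have "orientation_det v a = orientation_det (\<Sum>b\<in>Basis. (v \<bullet> b) *\<^sub>R b) a"
    by (simp add: euclidean_representation)
  also have "\<dots> = v \<bullet> hyperplane_normal a"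
    by (simp add: sum scale hyperplane_normal_def inner_sum_right mult.commute)
  finally show ?thesis by simp
qed

lemma continuous_on_hyperplane_normal [continuous_intros]:
  assumes "\<And>i. continuous_on S (\<lambda>x. g x i)"
  shows "continuous_on S (\<lambda>x. hyperplane_normal (g x))"
  unfolding hyperplane_normal_def using assms by (intro continuous_intros)

lemma hyperplane_normal_orthogonal:
  "hyperplane_normal a \<bullet> (a i - a j) = 0"
  by (simp add: inner_commute[of "hyperplane_normal a"] inner_hyperplane_normal
      orientation_det_diff_eq_0)

text \<open>Its inner product with any nonzero normal \<open>w\<close> of the spanned hyperplane is
  a nonzero determinant.\<close>

lemma hyperplane_normal_nonzero:
  fixes a :: "'n::finite \<Rightarrow> real^'n"
  assumes dim: "aff_dim (range a) = int CARD('n) - 1"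
  shows "hyperplane_normal a \<noteq> 0"
proof -
  obtain w t where w: "w \<noteq> 0" and hull: "affine hull (range a) = {x. w \<bullet> x = t}"
    using dim aff_dim_eq_hyperplane[of "range a"] by auto
  have "w \<bullet> a i = t" for i
    using hull hull_subset[of "range a" affine] by blast
  then have "orientation_det w a \<noteq> 0"
    using w dim by (intro orientation_det_nonzero) (simp_all add: inner_diff_right)
  then show ?thesis
    by (metis inner_hyperplane_normal inner_zero_right)
qed

text \<open>Removing from \<open>v\<close> its component along \<open>hyperplane_normal a\<close>
  leaves a vector that is still normal to the hyperplane but has determinant zero; by
  \<open>orientation_det_nonzero\<close> it is zero.\<close>

lemma normal_collinear_hyperplane_normal:
  fixes a :: "'n::finite \<Rightarrow> real^'n"
  assumes dim: "aff_dim (range a) = int CARD('n) - 1"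
    and perp: "\<And>i j. v \<bullet> (a i - a j) = 0"
  obtains c where "v = c *\<^sub>R hyperplane_normal a"
proof
  let ?N = "hyperplane_normal a"
  define c where "c = (v \<bullet> ?N) / (?N \<bullet> ?N)"
  have "orientation_det (v - c *\<^sub>R ?N) a = 0"
    using hyperplane_normal_nonzero[OF dim]
    by (simp add: c_def inner_diff_left flip: inner_hyperplane_normal)
  moreover have "(v - c *\<^sub>R ?N) \<bullet> (a i - a j) = 0" for i j
    using perp[of i j] hyperplane_normal_orthogonal[of a i j] by (simp add: inner_diff_left)
  ultimately show "v = c *\<^sub>R ?N"
    using orientation_det_nonzero[OF dim, of "v - c *\<^sub>R ?N"] by auto
qed

text \<open>A level set of \<open>v\<close> through one point of \<open>S\<close> is affine and
  contains \<open>S\<close>, hence contains the hull.\<close>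

lemma orthogonal_affine_hull:
  assumes "\<And>x y. x \<in> S \<Longrightarrow> y \<in> S \<Longrightarrow> v \<bullet> (x - y) = 0"
    and "x \<in> affine hull S" "y \<in> affine hull S"
  shows "v \<bullet> (x - y) = 0"
proof -
  obtain z where z: "z \<in> S"
    using assms(2) by (metis affine_hull_empty empty_iff ex_in_conv)
  have "affine hull S \<subseteq> {x. v \<bullet> x = v \<bullet> z}"
    using assms(1)[OF _ z] by (intro hull_minimal) (auto simp: affine_hyperplane inner_diff_right)
  then show ?thesis
    using assms(2,3) by (simp add: inner_diff_right subset_iff)
qed

text \<open>This justifies the definite description in \<open>positive_normal\<close>. Every normal
  is a multiple of \<open>hyperplane_normal a\<close>; positivity of the determinant fixes the sign
  of the factor and unit length its size.\<close>

lemma positive_normal_ex1: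
  fixes a :: "'n::finite \<Rightarrow> real^'n"
  assumes dim: "aff_dim (range a) = int CARD('n) - 1"
  shows "\<exists>!v. norm v = 1 \<and>
      (\<forall>x\<in>affine hull range a. \<forall>y\<in>affine hull range a. v \<bullet> (x - y) = 0) \<and>
      orientation_det v a > 0"
proof (rule ex1I)
  let ?N = "hyperplane_normal a"
  have nz: "?N \<noteq> 0"
    using dim by (rule hyperplane_normal_nonzero)
  have pos: "orientation_det (?N /\<^sub>R norm ?N) a > 0"
    using nz by (simp flip: inner_hyperplane_normal)
  have perp: "(?N /\<^sub>R norm ?N) \<bullet> (x - y) = 0"
    if "x \<in> affine hull (range a)" "y \<in> affine hull (range a)" for x y
  proof (rule orthogonal_affine_hull[OF _ that])
    show "(?N /\<^sub>R norm ?N) \<bullet> (x - y) = 0" if "x \<in> range a" "y \<in> range a" for x y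
      using that hyperplane_normal_orthogonal[of a] by force
  qed
  have "norm (?N /\<^sub>R norm ?N) = 1"
    using nz by simp
  then show "norm (?N /\<^sub>R norm ?N) = 1 \<and>
      (\<forall>x\<in>affine hull range a. \<forall>y\<in>affine hull range a. (?N /\<^sub>R norm ?N) \<bullet> (x - y) = 0) \<and>
      orientation_det (?N /\<^sub>R norm ?N) a > 0"
    using pos perp by blast
  fix v
  assume v: "norm v = 1 \<and>
      (\<forall>x\<in>affine hull range a. \<forall>y\<in>affine hull range a. v \<bullet> (x - y) = 0) \<and>
      orientation_det v a > 0"
  then have "v \<bullet> (a i - a j) = 0" for i j
    by (meson hull_inc rangeI)
  then obtain c where c: "v = c *\<^sub>R ?N"
    using normal_collinear_hyperplane_normal[OF dim] by blast
  have "c * (?N \<bullet> ?N) > 0"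
    using v unfolding inner_hyperplane_normal[symmetric] c by simp
  then have "c > 0"
    using nz by (metis inner_gt_zero_iff zero_less_mult_pos2)
  moreover have "\<bar>c\<bar> * norm ?N = 1"
    using v unfolding c by simp
  ultimately have "c = inverse (norm ?N)"
    using nz by (simp add: field_simps)
  then show "v = ?N /\<^sub>R norm ?N"
    using c by simp
qed

lemma
  fixes a :: "'n::finite \<Rightarrow> real^'n"
  assumes dim: "aff_dim (range a) = int CARD('n) - 1"
  shows norm_positive_normal: "norm (positive_normal a) = 1"
    and orientation_det_positive_normal: "orientation_det (positive_normal a) a > 0"
  using theI'[OF positive_normal_ex1[OF dim]] by (simp_all add: positive_normal_def)

lemma positive_normal_eqI:
  fixes a :: "'n::finite \<Rightarrow> real^'n"
  assumes "aff_dim (range a) = int CARD('n) - 1"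
    and "norm v = 1" and perp: "\<And>i j. v \<bullet> (a i - a j) = 0" and "orientation_det v a > 0"
  shows "positive_normal a = v"
proof -
  have "v \<bullet> (x - y) = 0" if "x \<in> affine hull (range a)" "y \<in> affine hull (range a)" for x y
    using perp by (intro orthogonal_affine_hull[OF _ that]) blast
  then show ?thesis
    unfolding positive_normal_def using assms
    by (intro the1_equality positive_normal_ex1) auto
qed

section \<open>Volumes cut off by halfspaces\<close>

lemma lmeasurable_Int_halfspace_le:
  assumes "compact K"
  shows "K \<inter> halfspace_le v t \<in> lmeasurable"
proof -
  have "halfspace_le v t = {x. v \<bullet> x \<le> t}"
    by (simp add: halfspace_le_def inner_commute)
  then show ?thesis
    using assms by (simp add: lmeasurable_compact compact_Int_closed closed_halfspace_le)
qed

text \<open>Dominated convergence with the indicator of \<open>K\<close> as bound. Off the limiting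
  hyperplane, which is negligible since its normal is nonzero, the indicators of the halfspaces are
  eventually constant.\<close>

lemma continuous_on_measure_Int_halfspace_le:
  fixes K :: "'a::euclidean_space set" and v :: "'b::metric_space \<Rightarrow> 'a"
  assumes K: "compact K" and v: "continuous_on S v" and t: "continuous_on S t"
    and nz: "\<And>y. y \<in> S \<Longrightarrow> v y \<noteq> 0"
  shows "continuous_on S (\<lambda>y. measure lebesgue (K \<inter> halfspace_le (v y) (t y)))"
  unfolding continuous_on_sequentially
proof (intro allI ballI impI, elim conjE)
  fix y z assume y: "\<forall>n. y n \<in> S" and z: "z \<in> S" and lim: "y \<longlonglongrightarrow> z"
  define I :: "'b \<Rightarrow> 'a \<Rightarrow> real"
    where "I p = indicat_real (K \<inter> halfspace_le (v p) (t p))" for p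
  have int: "integrable lebesgue (I p)" for p
    unfolding I_def using lmeasurable_Int_halfspace_le[OF K]
    by (intro integrable_real_indicator) (simp_all only: fmeasurable_def mem_Collect_eq infinity_ennreal_def)
  have meas: "integral\<^sup>L lebesgue (I p) = measure lebesgue (K \<inter> halfspace_le (v p) (t p))" for p
    by (simp add: I_def)
  have vlim: "(\<lambda>n. v (y n)) \<longlonglongrightarrow> v z" and tlim: "(\<lambda>n. t (y n)) \<longlonglongrightarrow> t z"
    using v t y z lim by (auto simp: continuous_on_sequentially o_def)
  have "negligible {x. v z \<bullet> x = t z}"
    using nz[OF z] by (intro negligible_hyperplane) auto
  then have "AE x in lebesgue. x \<notin> {x. v z \<bullet> x = t z}"
    by (intro AE_not_in) (simp add: negligible_iff_null_sets)
  then have ae: "AE x in lebesgue. (\<lambda>n. I (y n) x) \<longlonglongrightarrow> I z x"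
  proof (rule AE_mp, intro AE_I2 impI)
    fix x assume "x \<notin> {x. v z \<bullet> x = t z}"
    then consider "x \<bullet> v z - t z < 0" | "x \<bullet> v z - t z > 0"
      by (force simp: inner_commute)
    moreover have xlim: "(\<lambda>n. x \<bullet> v (y n) - t (y n)) \<longlonglongrightarrow> x \<bullet> v z - t z"
      by (intro tendsto_intros vlim tlim)
    ultimately have "\<forall>\<^sub>F n in sequentially. I (y n) x = I z x"
    proof cases
      case 1
      from order_tendstoD(2)[OF xlim 1] show ?thesis
        by eventually_elim (use 1 in \<open>auto simp: I_def halfspace_le_def indicator_def\<close>)
    next
      case 2
      from order_tendstoD(1)[OF xlim 2] show ?thesis
        by eventually_elim (use 2 in \<open>auto simp: I_def halfspace_le_def indicator_def\<close>)
    qed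
    then show "(\<lambda>n. I (y n) x) \<longlonglongrightarrow> I z x"
      by (rule tendsto_eventually)
  qed
  have "(\<lambda>n. integral\<^sup>L lebesgue (I (y n))) \<longlonglongrightarrow> integral\<^sup>L lebesgue (I z)"
  proof (rule integral_dominated_convergence[OF _ _ _ ae])
    show "integrable lebesgue (indicat_real K)"
      using lmeasurable_compact[OF K]
      by (intro integrable_real_indicator) (simp_all only: fmeasurable_def mem_Collect_eq infinity_ennreal_def)
    show "AE x in lebesgue. norm (I (y n) x) \<le> indicat_real K x" for n
      by (auto simp: I_def indicator_def)
  qed (use int in auto)
  then show "((\<lambda>y. measure lebesgue (K \<inter> halfspace_le (v y) (t y))) \<circ> y) \<longlonglongrightarrow>
      measure lebesgue (K \<inter> halfspace_le (v z) (t z))"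
    by (simp add: meas o_def)
qed

text \<open>A convex body lies in the closure of its interior, so an open set that meets
  \<open>K\<close> also meets \<open>interior K\<close>.\<close>

lemma convex_body_Int_open_measure_pos:
  assumes "convex_body K" "open U" "x \<in> K" "x \<in> U" "K \<inter> U \<in> lmeasurable"
  shows "measure lebesgue (K \<inter> U) > 0"
proof -
  have "x \<in> closure (interior K)"
    using assms convex_closure_interior[of K] closure_subset[of K]
    by (auto simp: convex_body_def)
  then have "interior K \<inter> U \<noteq> {}"
    using assms open_Int_closure_eq_empty[of U "interior K"] by auto
  then have "\<not> negligible (interior K \<inter> U)"
    using assms by (intro open_not_negligible) auto
  then have "\<not> negligible (K \<inter> U)"
    using interior_subset by (meson Int_mono negligible_subset order_refl)
  then show ?thesis
    using assms(5) by (simp add: negligible_iff_measure zero_less_measure_iff order_less_le)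
qed

lemma lmeasurable_Int_open:
  fixes K :: "'a::euclidean_space set"
  assumes "compact K" "open U"
  shows "K \<inter> U \<in> lmeasurable"
  using assms by (simp add: fmeasurable_Int_fmeasurable lmeasurable_compact)

text \<open>Since the two hyperplanes do not meet inside \<open>K\<close>, the part of
  \<open>K\<close> below the first lies strictly below the second, and the open slab between them
  adds positive volume.\<close>

lemma convex_body_measure_Int_halfspace_le_less:
  assumes K: "convex_body K"
    and a: "a \<in> K" "a \<bullet> v = t" "a \<bullet> w < s"
    and b: "b \<in> K" "b \<bullet> w = s" "b \<bullet> v > t"
    and disj: "\<And>x. x \<in> K \<Longrightarrow> x \<bullet> v = t \<Longrightarrow> x \<bullet> w \<noteq> s"
  shows "measure lebesgue (K \<inter> halfspace_le v t) < measure lebesgue (K \<inter> halfspace_le w s)"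
proof -
  have conv: "convex K" and comp: "compact K"
    using K by (auto simp: convex_body_def)
  \<comment> \<open>Otherwise two intermediate value arguments give a common point in
    \<open>K\<close>: going from \<open>a\<close> to \<open>x\<close> below the first hyperplane
    hits the second one at \<open>y\<close>, and going from \<open>y\<close> to \<open>b\<close>
    inside the second hits the first.\<close>
  have below: "x \<bullet> w < s" if x: "x \<in> K" "x \<bullet> v \<le> t" for x
  proof (rule ccontr)
    assume "\<not> x \<bullet> w < s"
    moreover have "connected (K \<inter> {x. v \<bullet> x \<le> t})"
      by (intro convex_connected convex_Int conv convex_halfspace_le)
    ultimately obtain y where y: "y \<in> K" "y \<bullet> v \<le> t" "y \<bullet> w = s"
      using connected_ivt_hyperplane[of "K \<inter> {x. v \<bullet> x \<le> t}" a x w s] x a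
      by (auto simp: inner_commute)
    have "connected (K \<inter> {x. w \<bullet> x = s})"
      by (intro convex_connected convex_Int conv convex_hyperplane)
    then obtain z where "z \<in> K" "z \<bullet> w = s" "z \<bullet> v = t"
      using connected_ivt_hyperplane[of "K \<inter> {x. w \<bullet> x = s}" y b v t] y b
      by (auto simp: inner_commute)
    then show False
      using disj by blast
  qed
  \<comment> \<open>The midpoint of \<open>a\<close> and \<open>b\<close> witnesses that this open
    region meets \<open>K\<close>.\<close>
  define U where "U = {x. v \<bullet> x > t} \<inter> {x. w \<bullet> x < s}"
  have "open U"
    by (simp add: U_def open_Int open_halfspace_gt open_halfspace_lt)
  have "midpoint a b \<in> K"
    using conv a b by (auto simp: midpoint_def scaleR_right_distrib convex_def)
  moreover have "midpoint a b \<in> U"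
    using a b by (simp add: U_def midpoint_def inner_commute[of v] inner_commute[of w] inner_add_left)
  moreover have meas: "K \<inter> U \<in> lmeasurable"
    using comp \<open>open U\<close> by (rule lmeasurable_Int_open)
  ultimately have "measure lebesgue (K \<inter> U) > 0"
    using K \<open>open U\<close> by (intro convex_body_Int_open_measure_pos)
  then have "measure lebesgue (K \<inter> halfspace_le v t) <
      measure lebesgue (K \<inter> halfspace_le v t) + measure lebesgue (K \<inter> U)"
    by simp
  also have "\<dots> = measure lebesgue ((K \<inter> halfspace_le v t) \<union> (K \<inter> U))"
  proof -
    have "(K \<inter> halfspace_le v t) \<inter> (K \<inter> U) = {}"
      by (auto simp: U_def halfspace_le_def inner_commute)
    then show ?thesis
      using meas lmeasurable_Int_halfspace_le[OF comp] by (simp add: measure_Un3)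
  qed
  also have "\<dots> \<le> measure lebesgue (K \<inter> halfspace_le w s)"
  proof (rule measure_mono_fmeasurable)
    show "K \<inter> halfspace_le v t \<union> K \<inter> U \<subseteq> K \<inter> halfspace_le w s"
      using below by (auto simp: U_def halfspace_le_def inner_commute less_imp_le)
    show "K \<inter> halfspace_le v t \<union> K \<inter> U \<in> sets lebesgue"
      using meas lmeasurable_Int_halfspace_le[OF comp] by (intro sets.Un fmeasurableD) auto
  qed (rule lmeasurable_Int_halfspace_le[OF comp])
  finally show ?thesis .
qed

text \<open>If the hyperplanes meet inside \<open>K\<close>, a common point serves as both
  \<open>a\<close> and \<open>b\<close>. Otherwise any two points do: opposite signs would make the
  volumes differ by the preceding strict inequality, applied in one order or the other.\<close>

lemma equal_volume_halfspaces_points: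
  assumes K: "convex_body K"
    and meet: "K \<inter> level_hyperplane v t \<noteq> {}" "K \<inter> level_hyperplane w s \<noteq> {}"
    and vol: "measure lebesgue (K \<inter> halfspace_le v t) = measure lebesgue (K \<inter> halfspace_le w s)"
  obtains a b where "a \<in> K" "a \<bullet> v = t" "b \<in> K" "b \<bullet> w = s"
    "a = b \<or> (a \<bullet> w - s) * (b \<bullet> v - t) > 0"
proof (cases "\<exists>x\<in>K. x \<bullet> v = t \<and> x \<bullet> w = s")
  case True
  then show ?thesis
    using that by blast
next
  case False
  obtain a b where a: "a \<in> K" "a \<bullet> v = t" and b: "b \<in> K" "b \<bullet> w = s"
    using meet by (auto simp: level_hyperplane_def)
  have "\<not> (a \<bullet> w < s \<and> b \<bullet> v > t)"
    using convex_body_measure_Int_halfspace_le_less[OF K a _ b] False vol by auto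
  moreover have "\<not> (a \<bullet> w > s \<and> b \<bullet> v < t)"
    using convex_body_measure_Int_halfspace_le_less[OF K b _ a] False vol by auto
  moreover have "a \<bullet> w \<noteq> s" "b \<bullet> v \<noteq> t"
    using a b False by auto
  ultimately have "(a \<bullet> w - s) * (b \<bullet> v - t) > 0"
    by (auto simp: zero_less_mult_iff neq_iff)
  then show ?thesis
    using that a b by blast
qed

section \<open>Transversals of a well separated family\<close>

text \<open>Well separation is applied to the whole family. It speaks of choices on the sets
  themselves, so injectivity of \<open>K\<close> is what turns a choice by index into one of
  these.\<close>

lemma well_separated_aff_dim_range:
  fixes K :: "'n::finite \<Rightarrow> (real^'n) set"
  assumes "inj K" "well_separated (range K)" "\<And>i. a i \<in> K i"
  shows "aff_dim (range a) = int CARD('n) - 1"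
proof -
  define x where "x A = a (inv K A)" for A
  have x: "x (K i) = a i" for i
    using \<open>inj K\<close> by (simp add: x_def)
  have card: "card (range K) = CARD('n)"
    using \<open>inj K\<close> by (simp add: card_image)
  have pos: "1 \<le> CARD('n)"
    by (simp add: Suc_leI)
  have "x A \<in> convex hull A" if "A \<in> range K" for A
    using that assms(3) x by (auto intro: hull_inc)
  then have "aff_dim (affine hull (x ` range K)) = int (card (range K)) - 1"
    using assms(2) card pos unfolding well_separated_def by auto
  then show ?thesis
    using card by (simp add: image_image x)
qed

text \<open>A change of sign would force a zero in between, but the determinant of a nonzero normal
  never vanishes.\<close>

lemma orientation_det_pos_along_path:
  fixes w :: "real \<Rightarrow> real^'n::finite" and c :: "real \<Rightarrow> 'n \<Rightarrow> real^'n"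
  assumes cont: "continuous_on {0..1} w" "\<And>i. continuous_on {0..1} (\<lambda>s. c s i)"
    and dim: "\<And>s. s \<in> {0..1} \<Longrightarrow> aff_dim (range (c s)) = int CARD('n) - 1"
    and nz: "\<And>s. s \<in> {0..1} \<Longrightarrow> w s \<noteq> 0"
    and perp: "\<And>s i j. s \<in> {0..1} \<Longrightarrow> w s \<bullet> (c s i - c s j) = 0"
    and "orientation_det (w 0) (c 0) > 0"
  shows "orientation_det (w 1) (c 1) > 0"
proof (rule ccontr)
  assume "\<not> ?thesis"
  moreover have "continuous_on {0..1} (\<lambda>s. orientation_det (w s) (c s))"
    using cont by (rule continuous_on_orientation_det)
  ultimately obtain s where "0 \<le> s" "s \<le> 1" "orientation_det (w s) (c s) = 0"
    using IVT2'[of "\<lambda>s. orientation_det (w s) (c s)" 1 0 0] assms(6) by auto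
  then show False
    using orientation_det_nonzero[OF dim nz perp, of s] by auto
qed

text \<open>The orientation does not depend on the chosen points: moving each \<open>a i\<close>
  straight to \<open>b i\<close> stays inside both \<open>K i\<close> and the hyperplane.\<close>

lemma orientation_det_pos_transversal:
  fixes K :: "'n::finite \<Rightarrow> (real^'n) set"
  assumes sep: "\<And>a. (\<And>i. a i \<in> K i) \<Longrightarrow> aff_dim (range a) = int CARD('n) - 1"
    and conv: "\<And>i. convex (K i)" and "v \<noteq> 0"
    and a: "\<And>i. a i \<in> K i" "\<And>i. a i \<bullet> v = t"
    and b: "\<And>i. b i \<in> K i" "\<And>i. b i \<bullet> v = t"
    and pos: "orientation_det v a > 0"
  shows "orientation_det v b > 0"
proof -
  define c where "c s i = (1 - s) *\<^sub>R a i + s *\<^sub>R b i" for s i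
  have "c s i \<bullet> v = t" for s i
    using a(2)[of i] b(2)[of i] by (simp add: c_def inner_add_left algebra_simps)
  then have perp: "v \<bullet> (c s i - c s j) = 0" for s i j
    by (simp add: inner_diff_right inner_commute[of v])
  have "c s i \<in> K i" if "s \<in> {0..1}" for s i
    using convexD_alt[OF conv a(1) b(1)] that by (simp add: c_def)
  then have "aff_dim (range (c s)) = int CARD('n) - 1" if "s \<in> {0..1}" for s
    using sep that by blast
  moreover have "continuous_on {0..1} (\<lambda>s. c s i)" for i
    unfolding c_def by (intro continuous_intros)
  moreover have ends: "c 0 = a" "c 1 = b"
    by (auto simp: c_def)
  ultimately show ?thesis
    using orientation_det_pos_along_path[of "\<lambda>_. v" c] perp pos \<open>v \<noteq> 0\<close> by auto
qed

text \<open>This trades the definite description for a unit vector with positive determinant, the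
  form in which existence and uniqueness are proved.\<close>

lemma positive_transversal_halfspace_iff:
  fixes K :: "'n::finite \<Rightarrow> (real^'n) set"
  assumes sep: "\<And>a. (\<And>i. a i \<in> K i) \<Longrightarrow> aff_dim (range a) = int CARD('n) - 1"
  shows "positive_transversal_halfspace K H \<longleftrightarrow>
    (\<exists>v t a. norm v = 1 \<and> H = halfspace_le v t \<and> (\<forall>i. a i \<in> K i \<and> a i \<bullet> v = t) \<and>
       orientation_det v a > 0)"
    (is "_ \<longleftrightarrow> ?R")
proof
  assume ?R
  then obtain v t a where v: "norm v = 1" and H: "H = halfspace_le v t"
    and a: "\<forall>i. a i \<in> K i \<and> a i \<bullet> v = t" and pos: "orientation_det v a > 0"
    by blast
  have dim: "aff_dim (range a) = int CARD('n) - 1"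
    using sep a by blast
  have perp: "v \<bullet> (a i - a j) = 0" for i j
    using a by (simp add: inner_diff_right inner_commute[of v])
  have "v = positive_normal a"
    using positive_normal_eqI[OF dim v perp pos] by simp
  moreover have "transversal_hyperplane (range K) (level_hyperplane v t)"
  proof -
    have eq: "level_hyperplane v t = {x. v \<bullet> x = t}"
      by (auto simp: level_hyperplane_def inner_commute)
    have "v \<noteq> 0"
      using v by auto
    moreover have "level_hyperplane v t \<inter> K i \<noteq> {}" for i
      using a by (auto simp: level_hyperplane_def)
    ultimately show ?thesis
      unfolding transversal_hyperplane_def
      by (simp add: eq affine_hyperplane)
  qed
  ultimately show "positive_transversal_halfspace K H"
    unfolding positive_transversal_halfspace_def using a H
    by (intro exI[of _ "level_hyperplane v t"] exI[of _ a] exI[of _ t])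
      (simp add: level_hyperplane_def)
next
  assume "positive_transversal_halfspace K H"
  then obtain L a t where L: "\<forall>i. a i \<in> K i \<inter> L" "L = level_hyperplane (positive_normal a) t"
    "H = halfspace_le (positive_normal a) t"
    unfolding positive_transversal_halfspace_def by blast
  then have dim: "aff_dim (range a) = int CARD('n) - 1"
    using sep by blast
  show ?R
    using L norm_positive_normal[OF dim] orientation_det_positive_normal[OF dim]
    by (intro exI[of _ "positive_normal a"] exI[of _ t] exI[of _ a])
      (simp add: level_hyperplane_def)
qed

section \<open>Uniqueness by deforming one hyperplane into the other\<close>

lemma halfspace_le_unique:
  fixes K :: "'n::finite \<Rightarrow> (real^'n) set"
  assumes sep: "\<And>a. (\<And>i. a i \<in> K i) \<Longrightarrow> aff_dim (range a) = int CARD('n) - 1"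
    and body: "\<And>i. convex_body (K i)"
    and v: "norm v = 1" "\<And>i. p i \<in> K i \<and> p i \<bullet> v = t" "orientation_det v p > 0"
    and w: "norm w = 1" "\<And>i. q i \<in> K i \<and> q i \<bullet> w = u" "orientation_det w q > 0"
    and vol: "\<And>i. measure lebesgue (K i \<inter> halfspace_le v t) = measure lebesgue (K i \<inter> halfspace_le w u)"
  shows "v = w \<and> t = u"
proof -
  have conv: "convex (K i)" for i
    using body by (simp add: convex_body_def)
  have ex: "\<exists>a b. a \<in> K i \<and> a \<bullet> v = t \<and> b \<in> K i \<and> b \<bullet> w = u \<and>
      (a = b \<or> (a \<bullet> w - u) * (b \<bullet> v - t) > 0)" for i
  proof -
    have "K i \<inter> level_hyperplane v t \<noteq> {}" "K i \<inter> level_hyperplane w u \<noteq> {}"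
      using v(2)[of i] w(2)[of i] by (auto simp: level_hyperplane_def)
    then show ?thesis
      by (rule equal_volume_halfspaces_points[OF body _ _ vol]) blast
  qed
  have "\<exists>a b. \<forall>i. a i \<in> K i \<and> a i \<bullet> v = t \<and> b i \<in> K i \<and> b i \<bullet> w = u \<and>
      (a i = b i \<or> (a i \<bullet> w - u) * (b i \<bullet> v - t) > 0)"
    using ex by metis
  then obtain a b where a: "\<And>i. a i \<in> K i" "\<And>i. a i \<bullet> v = t"
    and b: "\<And>i. b i \<in> K i" "\<And>i. b i \<bullet> w = u"
    and ab: "\<And>i. a i = b i \<or> (a i \<bullet> w - u) * (b i \<bullet> v - t) > 0"
    by fast
  have nz: "v \<noteq> 0" "w \<noteq> 0"
    using v(1) w(1) by auto
  \<comment> \<open>The points \<open>a\<close> and \<open>b\<close> come from the volume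
    comparison, so positivity has to be carried over from \<open>p\<close> and
    \<open>q\<close>.\<close>
  have pos_a: "orientation_det v a > 0"
    by (rule orientation_det_pos_transversal[of K v p t a]) (use sep conv nz a v in auto)
  have pos_b: "orientation_det w b > 0"
    by (rule orientation_det_pos_transversal[of K w q u b]) (use sep conv nz b w in auto)
  define z where "z s = (1 - s) *\<^sub>R v - s *\<^sub>R w" for s :: real
  \<comment> \<open>The affine function
    \<open>(1 - s) * (x \<bullet> v - t) - s * (x \<bullet> w - u)\<close> takes the value
    \<open>- s * (a i \<bullet> w - u)\<close> at \<open>a i\<close> and
    \<open>(1 - s) * (b i \<bullet> v - t)\<close> at \<open>b i\<close>; \<open>m s i\<close>
    locates its zero on the segment. If \<open>a i = b i\<close>, both summands vanish there and any
    parameter would do.\<close>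
  define m where "m s i = (if a i = b i then 0 else
     s * (a i \<bullet> w - u) / ((1 - s) * (b i \<bullet> v - t) + s * (a i \<bullet> w - u)))" for s i
  define c where "c s i = (1 - m s i) *\<^sub>R a i + m s i *\<^sub>R b i" for s i
  have denom: "\<bar>(1 - s) * (b i \<bullet> v - t) + s * (a i \<bullet> w - u)\<bar> > 0 \<and> m s i \<in> {0..1}"
    if s: "s \<in> {0..1}" and ne: "a i \<noteq> b i" for s i
  proof -
    define p q where "p = a i \<bullet> w - u" and "q = b i \<bullet> v - t"
    consider "p > 0" "q > 0" | "p < 0" "q < 0"
      using ab[of i] ne by (auto simp: p_def q_def zero_less_mult_iff)
    then show ?thesis
    proof cases
      case 1
      \<comment> \<open>At \<open>s = 0\<close> the sum is just \<open>q\<close>; for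
        \<open>s > 0\<close> the term \<open>s * p\<close> is strictly positive.\<close>
      then have "(1 - s) * q \<ge> 0" "s * p \<ge> 0" "(1 - s) * q + s * p > 0"
        using s by (simp_all, cases "s = 0", simp_all add: add_nonneg_pos)
      then show ?thesis
        using ne by (simp add: m_def flip: p_def q_def)
    next
      case 2
      then have "(1 - s) * q \<le> 0" "s * p \<le> 0" "(1 - s) * q + s * p < 0"
        using s by (simp_all add: mult_le_0_iff, cases "s = 0",
          simp_all add: add_nonpos_neg mult_le_0_iff mult_less_0_iff)
      then show ?thesis
        using ne by (simp add: m_def divide_le_eq zero_le_divide_iff flip: p_def q_def)
    qed
  qed
  have c_level: "c s i \<bullet> z s = (1 - s) * t - s * u" if "s \<in> {0..1}" for s i
  proof (cases "a i = b i")
    case True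
    then show ?thesis
      using a(2)[of i] b(2)[of i]
      by (simp add: c_def m_def z_def inner_diff_right)
  next
    case False
    define p q where "p = a i \<bullet> w - u" and "q = b i \<bullet> v - t"
    have "(1 - m s i) * (s * p) = m s i * ((1 - s) * q)"
      using denom[OF that False] False
      by (simp add: m_def field_simps flip: p_def q_def)
    moreover have "c s i \<bullet> z s - ((1 - s) * t - s * u) =
        m s i * ((1 - s) * q) - (1 - m s i) * (s * p)"
      using a(2)[of i] b(2)[of i]
      by (simp add: c_def z_def p_def q_def inner_add_left inner_diff_right algebra_simps)
    ultimately show ?thesis
      by simp
  qed
  have perp: "z s \<bullet> (c s i - c s j) = 0" if "s \<in> {0..1}" for s i j
    using c_level[OF that] by (simp add: inner_diff_right inner_commute[of "z s"])
  have "c s i \<in> K i" if "s \<in> {0..1}" for s i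
  proof (cases "a i = b i")
    case True
    then show ?thesis
      using a(1)[of i] by (simp add: c_def m_def)
  next
    case False
    then show ?thesis
      unfolding c_def using convexD_alt[OF conv a(1) b(1)] denom[OF that] by simp
  qed
  then have dim: "aff_dim (range (c s)) = int CARD('n) - 1" if "s \<in> {0..1}" for s
    using sep that by blast
  have cont_c: "continuous_on {0..1} (\<lambda>s. c s i)" for i
  proof (cases "a i = b i")
    case False
    have "(1 - s) * (b i \<bullet> v - t) + s * (a i \<bullet> w - u) \<noteq> 0" if "s \<in> {0..1}" for s
      using denom[OF that False] by simp
    then have "continuous_on {0..1} (\<lambda>s. s * (a i \<bullet> w - u) /
        ((1 - s) * (b i \<bullet> v - t) + s * (a i \<bullet> w - u)))"
      by (intro continuous_intros) auto
    then have "continuous_on {0..1} (\<lambda>s. m s i)"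
      using False by (simp add: m_def)
    then show ?thesis
      unfolding c_def by (intro continuous_intros)
  qed (simp add: c_def m_def)
  have cont_z: "continuous_on {0..1} z"
    unfolding z_def by (intro continuous_intros)
  have ends: "c 0 = a" "c 1 = b" "z 0 = v" "z 1 = - w"
  proof -
    have "c 1 i = b i" for i
      using denom[of 1 i] by (cases "a i = b i") (auto simp: c_def m_def)
    then show "c 1 = b" by (rule ext)
    show "c 0 = a" by (rule ext) (simp add: c_def m_def)
  qed (simp_all add: z_def)
  \<comment> \<open>If \<open>z\<close> had no zero, positivity would persist up to
    \<open>s = 1\<close>, where the normal is \<open>- w\<close> and the determinant is
    negative.\<close>
  have "\<exists>s\<in>{0..1}. z s = 0"
  proof (rule ccontr)
    assume "\<not> ?thesis"
    then have "orientation_det (z 1) (c 1) > 0"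
      using orientation_det_pos_along_path[OF cont_z cont_c dim _ perp] pos_a ends by metis
    then show False
      using pos_b linear_neg[OF linear_orientation_det[of b], of w] by (simp add: ends)
  qed
  then obtain s where s: "s \<in> {0..1}" "(1 - s) *\<^sub>R v = s *\<^sub>R w"
    by (auto simp: z_def)
  have "norm ((1 - s) *\<^sub>R v) = norm (s *\<^sub>R w)"
    by (simp only: s(2))
  then have "1 - s = s"
    using s(1) v(1) w(1) by simp
  then have half: "s = 1 / 2"
    by simp
  obtain i :: 'n where True by simp
  have "v = w"
    using s(2) half by simp
  \<comment> \<open>At \<open>s = 1 / 2\<close> the normal \<open>z s\<close> is zero, so the level
    \<open>(1 - s) * t - s * u\<close> is zero too.\<close>
  moreover have "t = u"
    using c_level[OF s(1), of i] s half by (simp add: z_def)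
  ultimately show ?thesis ..
qed

section \<open>Existence by Brouwer's fixed point theorem\<close>

text \<open>The product of the bodies is realised inside a Euclidean space of vectors of vectors,
  where Brouwer's theorem applies.\<close>

lemma compact_vec_components:
  fixes K :: "'n::finite \<Rightarrow> 'a::euclidean_space set"
  assumes "\<And>i. compact (K i)"
  shows "compact {y :: 'a^'n. \<forall>i. y $ i \<in> K i}"
proof -
  let ?S = "{y :: 'a^'n. \<forall>i. y $ i \<in> K i}"
  have "\<exists>B. \<forall>x\<in>K i. norm x \<le> B" for i
    using assms[of i] by (meson compact_imp_bounded bounded_iff)
  then obtain B where B: "\<And>i x. x \<in> K i \<Longrightarrow> norm x \<le> B i"
    by metis
  have "norm y \<le> sum B UNIV" if "y \<in> ?S" for y
  proof -
    have "norm y \<le> (\<Sum>i\<in>UNIV. norm (y $ i))"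
      unfolding norm_vec_def by (rule L2_set_le_sum) simp
    also have "\<dots> \<le> sum B UNIV"
      using that B by (intro sum_mono) simp
    finally show ?thesis .
  qed
  then have "bounded ?S"
    by (auto simp: bounded_iff)
  moreover have "closed ?S"
  proof -
    have "closed ((\<lambda>y :: 'a^'n. y $ i) -` K i)" for i
      using assms by (intro closed_vimage compact_imp_closed continuous_intros)
    then have "closed (\<Inter>i. (\<lambda>y :: 'a^'n. y $ i) -` K i)"
      by blast
    moreover have "?S = (\<Inter>i. (\<lambda>y. y $ i) -` K i)"
      by auto
    ultimately show ?thesis
      by simp
  qed
  ultimately show ?thesis
    by (simp add: compact_eq_bounded_closed)
qed

lemma convex_vec_components:
  fixes K :: "'n::finite \<Rightarrow> 'a::euclidean_space set"
  assumes "\<And>i. convex (K i)"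
  shows "convex {y :: 'a^'n. \<forall>i. y $ i \<in> K i}"
  using assms unfolding convex_def by simp

text \<open>If the volume error \<open>c\<close> were nonzero, the variational inequality for the projection would
  make \<open>y\<close> an extreme point of \<open>K\<close> in direction \<open>\<plusminus>n\<close>, so that the halfspace through \<open>y\<close> contains
  none or all of the volume, against the sign of \<open>c\<close>.\<close>

lemma projection_fixed_point_volume:
  assumes K: "compact K" "convex K" and "y \<in> K" and "n \<noteq> 0" and \<alpha>: "\<alpha> \<in> {0..1}"
    and c: "c = measure lebesgue (K \<inter> halfspace_le n (y \<bullet> n)) - \<alpha> * measure lebesgue K"
    and fixed: "closest_point K (y - c *\<^sub>R n) = y"
  shows "c = 0"
proof (rule ccontr)
  assume "c \<noteq> 0"
  have "(y - c *\<^sub>R n - y) \<bullet> (x - y) \<le> 0" if "x \<in> K" for x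
    using closest_point_dot[OF K(2) compact_imp_closed[OF K(1)] that, of "y - c *\<^sub>R n"]
    by (simp add: fixed)
  then have opt: "c * (n \<bullet> x - n \<bullet> y) \<ge> 0" if "x \<in> K" for x
    using that by (simp add: inner_diff_right right_diff_distrib)
  show False
  proof (cases "c > 0")
    case True
    then have "K \<inter> halfspace_le n (y \<bullet> n) \<subseteq> {x. n \<bullet> x = n \<bullet> y}"
      using opt by (force simp: halfspace_le_def inner_commute zero_le_mult_iff)
    then have "negligible (K \<inter> halfspace_le n (y \<bullet> n))"
      using negligible_hyperplane \<open>n \<noteq> 0\<close> negligible_subset by metis
    then have "measure lebesgue (K \<inter> halfspace_le n (y \<bullet> n)) = 0"
      by (rule negligible_imp_measure0)
    moreover have "\<alpha> * measure lebesgue K \<ge> 0"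
      using \<alpha> by simp
    ultimately show False
      using True c by simp
  next
    case False
    then have "K \<inter> halfspace_le n (y \<bullet> n) = K"
      using opt \<open>c \<noteq> 0\<close> by (force simp: halfspace_le_def inner_commute zero_le_mult_iff)
    moreover have "\<alpha> * measure lebesgue K \<le> measure lebesgue K"
      using \<alpha> by (intro mult_left_le_one_le) auto
    ultimately show False
      using False \<open>c \<noteq> 0\<close> c by simp
  qed
qed

lemma halfspace_le_exists:
  fixes K :: "'n::finite \<Rightarrow> (real^'n) set"
  assumes sep: "\<And>a. (\<And>i. a i \<in> K i) \<Longrightarrow> aff_dim (range a) = int CARD('n) - 1"
    and body: "\<And>i. convex_body (K i)"
    and \<alpha>: "\<And>i. \<alpha> i \<in> {0..1}"
  obtains v t a where "norm v = 1" "\<And>i. a i \<in> K i" "\<And>i. a i \<bullet> v = t" "orientation_det v a > 0"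
    "\<And>i. measure lebesgue (K i \<inter> halfspace_le v t) = \<alpha> i * measure lebesgue (K i)"
proof -
  have comp: "compact (K i)" and conv: "convex (K i)" and ne: "K i \<noteq> {}" for i
    using body[of i] by (auto simp: convex_body_def)
  define S where "S = {y :: (real^'n)^'n. \<forall>i. y $ i \<in> K i}"
  define n :: "(real^'n)^'n \<Rightarrow> real^'n" where "n y = hyperplane_normal (($) y)" for y
  \<comment> \<open>The offset \<open>y $ i \<bullet> n y\<close> is the same for every
    \<open>i\<close> by \<open>hyperplane_normal_orthogonal\<close>, so all the errors
    \<open>g i y\<close> refer to one halfspace.\<close>
  define g where "g i y = measure lebesgue (K i \<inter> halfspace_le (n y) (y $ i \<bullet> n y))
     - \<alpha> i * measure lebesgue (K i)" for i y
  \<comment> \<open>A positive error pushes \<open>y $ i\<close> against the normal and a negative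
    one along it; the projection brings the point back into \<open>K i\<close>.\<close>
  define F where "F y = (\<chi> i. closest_point (K i) (y $ i - g i y *\<^sub>R n y))" for y
  have dim: "aff_dim (range (($) y)) = int CARD('n) - 1" if "y \<in> S" for y
    using that by (intro sep) (simp add: S_def)
  have nz: "n y \<noteq> 0" if "y \<in> S" for y
    unfolding n_def using dim[OF that] by (rule hyperplane_normal_nonzero)
  have cont_n: "continuous_on S n"
    unfolding n_def by (intro continuous_on_hyperplane_normal continuous_intros)
  have cont_g: "continuous_on S (g i)" for i
    unfolding g_def
    by (intro continuous_on_diff continuous_on_const continuous_on_measure_Int_halfspace_le
        comp nz cont_n continuous_on_inner continuous_intros)
  obtain y where y: "y \<in> S" and fixed: "F y = y"
  proof (rule brouwer)
    show "compact S" "convex S"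
      unfolding S_def using comp conv by (simp_all add: compact_vec_components convex_vec_components)
    have "(\<chi> i. SOME x. x \<in> K i) \<in> S"
      using ne by (simp add: S_def some_in_eq)
    then show "S \<noteq> {}" by blast
    have "continuous_on S (\<lambda>y. closest_point (K i) (y $ i - g i y *\<^sub>R n y))" for i
      using continuous_on_closest_point[OF conv compact_imp_closed[OF comp] ne]
      by (rule continuous_on_compose2[where t = UNIV])
        (auto intro!: continuous_on_diff continuous_on_scaleR cont_g cont_n continuous_intros)
    then show "continuous_on S F"
      unfolding F_def by (intro continuous_on_vec_lambda)
    show "F \<in> S \<rightarrow> S"
      using closest_point_in_set[OF compact_imp_closed[OF comp] ne] by (auto simp: F_def S_def)
  qed
  have yK: "y $ i \<in> K i" for i
    using y by (simp add: S_def)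
  have vol: "g i y = 0" for i
  proof (rule projection_fixed_point_volume[OF comp conv yK nz[OF y] \<alpha> g_def])
    show "closest_point (K i) (y $ i - g i y *\<^sub>R n y) = y $ i"
      using arg_cong[OF fixed, of "\<lambda>z. z $ i"] by (simp add: F_def)
  qed
  obtain k :: 'n where True by simp
  define r where "r = norm (n y)"
  have r: "r > 0"
    using nz[OF y] by (simp add: r_def)
  have level: "y $ i \<bullet> n y = y $ k \<bullet> n y" for i
    using hyperplane_normal_orthogonal[of "($) y" i k]
    by (simp add: n_def inner_diff_right inner_commute)
  \<comment> \<open>Dividing normal and offset by \<open>r > 0\<close> gives a unit normal without
    changing the halfspace.\<close>
  have "halfspace_le (n y /\<^sub>R r) (y $ k \<bullet> n y / r) = halfspace_le (n y) (y $ i \<bullet> n y)" for i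
    using r level[of i] by (auto simp: halfspace_le_def field_simps)
  then have "measure lebesgue (K i \<inter> halfspace_le (n y /\<^sub>R r) (y $ k \<bullet> n y / r))
      = \<alpha> i * measure lebesgue (K i)" for i
    using vol[of i] by (simp add: g_def)
  moreover have "orientation_det (n y /\<^sub>R r) (($) y) > 0"
    using r nz[OF y] unfolding inner_hyperplane_normal[symmetric] by (simp flip: n_def)
  moreover have "y $ i \<bullet> (n y /\<^sub>R r) = y $ k \<bullet> n y / r" for i
    using level[of i] by (simp add: divide_inverse_commute)
  moreover have "norm (n y /\<^sub>R r) = 1"
    using r by (simp add: r_def)
  ultimately show ?thesis
    using that[of "n y /\<^sub>R r" "($) y"] yK by blast
qed

theorem theorem2:
  fixes K :: "'n::finite \<Rightarrow> (real^'n) set" and \<alpha> :: "'n \<Rightarrow> real"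
  assumes "inj K"
    and "\<And>i. convex_body (K i)"
    and "well_separated (range K)"
    and "\<And>i. \<alpha> i \<in> {0..1}"
  shows "\<exists>!H. positive_transversal_halfspace K H \<and>
              (\<forall>i. measure lebesgue (K i \<inter> H) = \<alpha> i * measure lebesgue (K i))"
proof -
  have sep: "aff_dim (range a) = int CARD('n) - 1" if "\<And>i. a i \<in> K i" for a
    using well_separated_aff_dim_range assms(1,3) that by blast
  have iff: "positive_transversal_halfspace K H \<longleftrightarrow>
      (\<exists>v t a. norm v = 1 \<and> H = halfspace_le v t \<and> (\<forall>i. a i \<in> K i \<and> a i \<bullet> v = t) \<and>
         orientation_det v a > 0)" for H
    by (rule positive_transversal_halfspace_iff) (rule sep)
  obtain v t a where vta: "norm v = 1" "\<And>i. a i \<in> K i" "\<And>i. a i \<bullet> v = t"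
    "orientation_det v a > 0"
    and vol: "\<And>i. measure lebesgue (K i \<inter> halfspace_le v t) = \<alpha> i * measure lebesgue (K i)"
    by (rule halfspace_le_exists[of K \<alpha>]) (use sep assms(2,4) in auto)
  show ?thesis
  proof (rule ex1I)
    show "positive_transversal_halfspace K (halfspace_le v t) \<and>
        (\<forall>i. measure lebesgue (K i \<inter> halfspace_le v t) = \<alpha> i * measure lebesgue (K i))"
      unfolding iff using vta vol by blast
  next
    fix H
    assume H: "positive_transversal_halfspace K H \<and>
        (\<forall>i. measure lebesgue (K i \<inter> H) = \<alpha> i * measure lebesgue (K i))"
    then obtain w u b where w: "norm w = 1" "\<And>i. b i \<in> K i \<and> b i \<bullet> w = u"
      "orientation_det w b > 0" and "H = halfspace_le w u"
      unfolding iff by blast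
    \<comment> \<open>Both halfspaces cut off the volumes prescribed by \<alpha>, so normals and
      offsets agree, and with them the sets.\<close>
    moreover have "w = v \<and> u = t"
      by (rule halfspace_le_unique[of K w b u v a t])
        (use sep assms(2) w vta vol H \<open>H = halfspace_le w u\<close> in auto)
    ultimately show "H = halfspace_le v t"
      by simp
  qed
qed

end
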